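(* There is a quasi-Banach space $\mathbb{Y}$ with an almost greedy basis $\mathcal{Y}=(\boldsymbol{y}_n)_{n=1}^\infty$ that fails to be a Schauder basis under any rearrangement, i.e., for every permutation $\pi$ of $\mathbb{N}$ the sequence $(\boldsymbol{y}_{\pi(n)})_{n=1}^\infty$ is not a Schauder basis of $\mathbb{Y}$. Furthermore, $\mathcal{Y}$ can be chosen to be symmetric.
   Context: Scalars are $\mathbb{F}=\mathbb{R}$ or $\mathbb{C}$. A quasi-norm satisfies the norm axioms except that the triangle inequality is weakened to $\|f+g\|\le\kappa(\|f\|+\|g\|)$; a quasi-Banach space is a complete quasi-normed space. A minimal system in $\mathbb{Y}$ is a sequence $(\boldsymbol{y}_n)$ for which there are $\boldsymbol{y}_n^*\in\mathbb{Y}^*$ with $\boldsymbol{y}_n^*(\boldsymbol{y}_k)=\delta_{n,k}$; it is complete if its closed linear span is $\mathbb{Y}$. A $W$-basis is a complete minimal system that is semi-normalized ($0<\inf_n\|\boldsymbol{y}_n\|\le\sup_n\|\boldsymbol{y}_n\|<\infty$) and $M$-bounded ($\sup_n\|\boldsymbol{y}_n\|\,\|\boldsymbol{y}_n^*\|<\infty$). For finite $A\subset\mathbb{N}$, $S_A(f)=\sum_{n\in A}\boldsymbol{y}_n^*(f)\boldsymbol{y}_n$. A finite set $A\subset\mathbb{N}$ is a greedy set of $f$ if $|\boldsymbol{y}_n^*(f)|\ge|\boldsymbol{y}_k^*(f)|$ for all $n\in A$, $k\in\mathbb{N}\setminus A$. An almost greedy basis is a $W$-basis for which there is $C$ such that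 $\|f-S_A(f)\|\le C\|f-S_B(f)\|$ for all $f\in\mathbb{Y}$, all greedy sets $A$ of $f$ and all finite $B\subset\mathbb{N}$ with $|B|\le|A|$. A Schauder basis is a sequence such that every $f\in\mathbb{Y}$ has a unique expansion $f=\sum_{n=1}^\infty a_n\boldsymbol{y}_n$ (convergent series). A minimal system is symmetric if there is $C$ with $\|\sum_n a_n\boldsymbol{y}_n\|\le C\|\sum_n a_n\boldsymbol{y}_{\pi(n)}\|$ for every finitely supported scalar sequence $(a_n)$ and every permutation $\pi$ of $\mathbb{N}$. *)

theory Defs
  imports "HOL-Analysis.Analysis" "HOL-Library.Function_Algebras"
begin

text \<open>
  Spaces are linear subspaces \<open>V\<close> of an ambient vector space, with a quasi-norm \<open>N\<close> of which
  only the values on \<open>V\<close> matter. The scalar field is used at the types \<^typ>\<open>real\<close> and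
  \<^typ>\<open>complex\<close>. Sequences are indexed from 0.
\<close>

locale quasi_normed_space = vector_space scale
  for scale :: "'k::real_normed_field \<Rightarrow> 'v::ab_group_add \<Rightarrow> 'v" +
  fixes V :: "'v set" and N :: "'v \<Rightarrow> real"
  assumes subspace_V: "subspace V"
    and N_nonneg: "f \<in> V \<Longrightarrow> 0 \<le> N f"
    and N_eq_0_iff: "f \<in> V \<Longrightarrow> N f = 0 \<longleftrightarrow> f = 0"
    and N_scale: "f \<in> V \<Longrightarrow> N (scale c f) = norm c * N f"
    and N_quasi_triangle: "\<exists>\<kappa>. \<forall>f\<in>V. \<forall>g\<in>V. N (f + g) \<le> \<kappa> * (N f + N g)"
begin

definition converges_to :: "(nat \<Rightarrow> 'v) \<Rightarrow> 'v \<Rightarrow> bool" where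
  "converges_to u f \<longleftrightarrow> (\<lambda>m. N (u m - f)) \<longlonglongrightarrow> 0"

definition cauchy_seq :: "(nat \<Rightarrow> 'v) \<Rightarrow> bool" where
  "cauchy_seq u \<longleftrightarrow> (\<forall>\<epsilon>>0. \<exists>M. \<forall>m\<ge>M. \<forall>n\<ge>M. N (u m - u n) < \<epsilon>)"

definition closed_span :: "'v set \<Rightarrow> 'v set" where
  "closed_span S = {f \<in> V. \<exists>u. range u \<subseteq> span S \<and> converges_to u f}"

definition dual :: "('v \<Rightarrow> 'k) set" where
  "dual = {\<phi>. (\<forall>f\<in>V. \<forall>g\<in>V. \<phi> (f + g) = \<phi> f + \<phi> g) \<and>
              (\<forall>c. \<forall>f\<in>V. \<phi> (scale c f) = c * \<phi> f) \<and>
              (\<exists>K. \<forall>f\<in>V. norm (\<phi> f) \<le> K * N f)}"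

definition dual_norm :: "('v \<Rightarrow> 'k) \<Rightarrow> real" where
  "dual_norm \<phi> = (SUP f\<in>{f \<in> V. N f \<le> 1}. norm (\<phi> f))"

definition biorthogonal :: "(nat \<Rightarrow> 'v) \<Rightarrow> (nat \<Rightarrow> 'v \<Rightarrow> 'k) \<Rightarrow> bool" where
  "biorthogonal y y' \<longleftrightarrow> range y \<subseteq> V \<and> range y' \<subseteq> dual \<and>
     (\<forall>n k. y' n (y k) = (if n = k then 1 else 0))"

definition minimal_system :: "(nat \<Rightarrow> 'v) \<Rightarrow> bool" where
  "minimal_system y \<longleftrightarrow> (\<exists>y'. biorthogonal y y')"

text \<open>
  For a complete minimal system the coordinate functionals \<open>y'\<close> are determined on \<open>V\<close> by \<open>y\<close>,
  so it does not matter that they are carried along as a parameter.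
\<close>

definition W_basis :: "(nat \<Rightarrow> 'v) \<Rightarrow> (nat \<Rightarrow> 'v \<Rightarrow> 'k) \<Rightarrow> bool" where
  "W_basis y y' \<longleftrightarrow> biorthogonal y y' \<and> closed_span (range y) = V \<and>
     0 < (INF n. N (y n)) \<and> bdd_above (range (\<lambda>n. N (y n))) \<and>
     bdd_above (range (\<lambda>n. N (y n) * dual_norm (y' n)))"

definition coord_proj :: "(nat \<Rightarrow> 'v) \<Rightarrow> (nat \<Rightarrow> 'v \<Rightarrow> 'k) \<Rightarrow> nat set \<Rightarrow> 'v \<Rightarrow> 'v" where
  "coord_proj y y' A f = (\<Sum>n\<in>A. scale (y' n f) (y n))"

definition greedy_set :: "(nat \<Rightarrow> 'v \<Rightarrow> 'k) \<Rightarrow> 'v \<Rightarrow> nat set \<Rightarrow> bool" where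
  "greedy_set y' f A \<longleftrightarrow> finite A \<and> (\<forall>n\<in>A. \<forall>k\<in>-A. norm (y' k f) \<le> norm (y' n f))"

definition almost_greedy_basis :: "(nat \<Rightarrow> 'v) \<Rightarrow> bool" where
  "almost_greedy_basis y \<longleftrightarrow> (\<exists>y'. W_basis y y' \<and>
     (\<exists>C. \<forall>f\<in>V. \<forall>A B. greedy_set y' f A \<and> finite B \<and> card B \<le> card A \<longrightarrow>
        N (f - coord_proj y y' A f) \<le> C * N (f - coord_proj y y' B f)))"

definition schauder_basis :: "(nat \<Rightarrow> 'v) \<Rightarrow> bool" where
  "schauder_basis y \<longleftrightarrow> range y \<subseteq> V \<and>
     (\<forall>f\<in>V. \<exists>!a. converges_to (\<lambda>m. \<Sum>n<m. scale (a n) (y n)) f)"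

definition symmetric_system :: "(nat \<Rightarrow> 'v) \<Rightarrow> bool" where
  "symmetric_system y \<longleftrightarrow> minimal_system y \<and>
     (\<exists>C. \<forall>a \<pi>. finite {n. a n \<noteq> 0} \<and> bij \<pi> \<longrightarrow>
        N (\<Sum>n\<in>{n. a n \<noteq> 0}. scale (a n) (y n))
          \<le> C * N (\<Sum>n\<in>{n. a n \<noteq> 0}. scale (a n) (y (\<pi> n))))"

end

locale quasi_banach_space = quasi_normed_space +
  assumes complete_V: "range u \<subseteq> V \<Longrightarrow> cauchy_seq u \<Longrightarrow> \<exists>f\<in>V. converges_to u f"

text \<open>
  The ambient space for existence statements is the space of all scalar sequences with pointwise
  operations, the quasi-norm and the subspace being arbitrary. This is no restriction for spaces
  with an almost greedy basis: their coordinate functionals separate points. Indeed, if all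
  coordinates of \<open>f\<close> vanish and \<open>g\<close> is in the span of the basis, then the support of \<open>g\<close> is a
  greedy set of \<open>f - g\<close>, so (comparing with \<open>B = {}\<close>) \<open>N f \<le> C * N (f - g)\<close>, and the right-hand
  side can be made arbitrarily small.
\<close>

definition seq_scale :: "'k::real_normed_field \<Rightarrow> (nat \<Rightarrow> 'k) \<Rightarrow> (nat \<Rightarrow> 'k)" where
  "seq_scale c f = (\<lambda>n. c * f n)"

lemma vector_space_seq_scale: "vector_space seq_scale"
  by unfold_locales (auto simp: seq_scale_def fun_eq_iff algebra_simps)

end

theory Submission
  imports Defs
begin

text \<open>
  For a scalar sequence \<open>f\<close> and \<open>t > 0\<close> let \<open>S\<^sub>t f\<close> be the sum of those entries of \<open>f\<close> whose
  modulus exceeds \<open>t\<close>. The quasi-norm is equivalent to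
  \<open>sup\<^sub>t t * card {n. t < |f n|} + sup\<^sub>t |S\<^sub>t f|\<close>, the weak \<open>l\<^sub>1\<close> quasi-norm plus the largest
  sum over a level set, and the space is the closure of the finitely supported sequences. The
  basis consists of the unit vectors.

  The map \<open>S\<^sub>t\<close> is not additive, but it is so up to a weak \<open>l\<^sub>1\<close> error: on a set \<open>F\<close> that
  contains the level sets of \<open>f\<close>, \<open>g\<close> and \<open>f + g\<close>, summation is additive, and replacing a level
  set by \<open>F\<close> adds at most \<open>card F\<close> entries of modulus at most \<open>t\<close>, where \<open>t * card F\<close> is
  controlled by the weak \<open>l\<^sub>1\<close> quasi-norms. This gives the quasi-triangle inequality
  (\<open>trunc_norm_triangle\<close>). The same comparison gives completeness (\<open>trunc_norm_limit_le\<close>) and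
  the almost greedy inequality (\<open>trunc_norm_greedy_le\<close>): greedy sums are, up to ties, sums over
  level sets, and these have been built into the quasi-norm.

  The quasi-norm does not change when a sequence is permuted, so the basis is symmetric, and it
  suffices to find one sequence in the space whose expansion diverges in the natural order:
  permuting that sequence defeats any other order. The point is that entries \<open>a\<close> and \<open>-a\<close> cancel
  in every \<open>S\<^sub>t\<close> wherever they stand. The sequence \<open>1, 1/2, \<dots>, 1/m, -1, -1/2, \<dots>, -1/m\<close> therefore
  has quasi-norm at most \<open>2\<close>, while the sum of its first half is the harmonic number of \<open>m\<close>. A
  series of such blocks with rapidly decreasing factors and still faster increasing lengths
  (\<open>ex_initial_parts_not_convergent\<close>) lies in the space, but its partial sums are not Cauchy.
\<close>

section \<open>The quasi-norm\<close>

definition exceed :: "(nat \<Rightarrow> 'k::real_normed_field) \<Rightarrow> real \<Rightarrow> nat set" where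
  "exceed f t = {n. t < norm (f n)}"

definition level_size :: "(nat \<Rightarrow> 'k::real_normed_field) \<Rightarrow> real \<Rightarrow> real" where
  "level_size f t = t * card (exceed f t) + norm (sum f (exceed f t))"

text \<open>
  Taking one supremum of the sum of the two terms, rather than the sum of two suprema, changes
  the quasi-norm by a factor of at most \<open>2\<close> and leaves a single bounded function to deal with.
  On sequences outside \<open>trunc_space\<close>, defined next, the value is meaningless.
\<close>

definition trunc_norm :: "(nat \<Rightarrow> 'k::real_normed_field) \<Rightarrow> real" where
  "trunc_norm f = (SUP t\<in>{0<..}. level_size f t)"

definition trunc_space :: "(nat \<Rightarrow> 'k::real_normed_field) set" where
  "trunc_space = {f. (\<forall>t>0. finite (exceed f t)) \<and> bdd_above (level_size f ` {0<..})}"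

lemma finite_exceed: "f \<in> trunc_space \<Longrightarrow> 0 < t \<Longrightarrow> finite (exceed f t)"
  by (simp add: trunc_space_def)

lemma level_size_le: "f \<in> trunc_space \<Longrightarrow> 0 < t \<Longrightarrow> level_size f t \<le> trunc_norm f"
  unfolding trunc_norm_def trunc_space_def by (intro cSUP_upper) auto

lemma card_exceed_le:
  assumes "f \<in> trunc_space" "0 < t"
  shows "t * card (exceed f t) \<le> trunc_norm f"
  using level_size_le[OF assms] norm_ge_zero[of "sum f (exceed f t)"]
  unfolding level_size_def by linarith

lemma norm_sum_exceed_le:
  assumes "f \<in> trunc_space" "0 < t"
  shows "norm (sum f (exceed f t)) \<le> trunc_norm f"
proof -
  have "0 \<le> t * card (exceed f t)" using assms by simp
  then show ?thesis using level_size_le[OF assms] unfolding level_size_def by linarith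
qed

lemma trunc_normI:
  assumes "\<And>t. 0 < t \<Longrightarrow> finite (exceed f t)"
    and "\<And>t. 0 < t \<Longrightarrow> t * card (exceed f t) \<le> a"
    and "\<And>t. 0 < t \<Longrightarrow> norm (sum f (exceed f t)) \<le> b"
  shows "f \<in> trunc_space" and "trunc_norm f \<le> a + b"
proof -
  have le: "level_size f t \<le> a + b" if "0 < t" for t
    unfolding level_size_def using assms(2,3)[OF that] by (rule add_mono)
  then have "bdd_above (level_size f ` {0<..})" by (intro bdd_aboveI2) auto
  with assms(1) show "f \<in> trunc_space" by (simp add: trunc_space_def)
  show "trunc_norm f \<le> a + b" unfolding trunc_norm_def using le by (intro cSUP_least) auto
qed

lemma trunc_norm_nonneg:
  assumes "f \<in> trunc_space"
  shows "0 \<le> trunc_norm f"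
  using norm_sum_exceed_le[OF assms zero_less_one] norm_ge_zero order_trans by blast

text \<open>
  An entry of modulus above \<open>t\<close> makes the level set at \<open>t\<close> nonempty. So convergence in
  \<open>trunc_norm\<close> is uniform, and the coordinate functionals are bounded.
\<close>

lemma norm_coord_le:
  assumes "f \<in> trunc_space"
  shows "norm (f n) \<le> trunc_norm f"
proof (cases "f n = 0")
  case True
  then show ?thesis using trunc_norm_nonneg[OF assms] by simp
next
  case False
  show ?thesis
  proof (rule dense_le_bounded[of 0])
    show "0 < norm (f n)" using False by simp
    fix t assume t: "0 < t" "t < norm (f n)"
    then have "n \<in> exceed f t" by (simp add: exceed_def)
    then have "card (exceed f t) \<ge> 1"
      using finite_exceed[OF assms t(1)] by (metis One_nat_def Suc_leI card_gt_0_iff empty_iff)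
    then have "t * 1 \<le> t * card (exceed f t)" using t by (intro mult_left_mono) auto
    then show "t \<le> trunc_norm f" using card_exceed_le[OF assms t(1)] by simp
  qed
qed

lemma norm_sum_small_le:
  fixes f :: "nat \<Rightarrow> 'k::real_normed_field"
  assumes "\<And>n. n \<in> G \<Longrightarrow> norm (f n) \<le> t" "G \<subseteq> F" "finite F" "0 \<le> t"
  shows "norm (sum f G) \<le> t * card F"
proof -
  have "norm (sum f G) \<le> (\<Sum>n\<in>G. t)" using assms(1) by (rule sum_norm_le)
  also have "\<dots> = t * card G" by simp
  also have "\<dots> \<le> t * card F" using assms by (intro mult_left_mono) (auto intro: card_mono)
  finally show ?thesis .
qed

text \<open>
  The comparison on which everything rests: the indices in \<open>F\<close> that lie outside the level set
  carry entries of modulus at most \<open>t\<close>. In applications \<open>t * card F\<close> is a weak \<open>l\<^sub>1\<close> quantity.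
\<close>

lemma norm_sum_diff_exceed_le:
  assumes "exceed f t \<subseteq> F" "finite F" "0 \<le> t"
  shows "norm (sum f F - sum f (exceed f t)) \<le> t * card F"
proof -
  have "sum f F - sum f (exceed f t) = sum f (F - exceed f t)"
    using assms by (simp add: sum_diff)
  also have "norm \<dots> \<le> t * card F"
    using assms by (intro norm_sum_small_le) (auto simp: exceed_def)
  finally show ?thesis .
qed

lemma norm_sum_le_of_exceed_subset:
  assumes "f \<in> trunc_space" "exceed f t \<subseteq> F" "finite F" "0 < t"
  shows "norm (sum f F) \<le> trunc_norm f + t * card F"
  using norm_sum_diff_exceed_le[OF assms(2,3)] norm_sum_exceed_le[OF assms(1,4)] assms(4)
    norm_triangle_sub[of "sum f F" "sum f (exceed f t)"] by linarith

lemma exceed_zero: "0 \<le> t \<Longrightarrow> exceed 0 t = {}"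
  by (auto simp: exceed_def)

lemma zero_in_trunc_space: "0 \<in> trunc_space"
  by (rule trunc_normI(1)[of _ 0 0]) (simp_all add: exceed_zero)

lemma trunc_norm_eq_0_iff:
  assumes "f \<in> trunc_space"
  shows "trunc_norm f = 0 \<longleftrightarrow> f = 0"
proof
  assume "trunc_norm f = 0"
  then show "f = 0" using norm_coord_le[OF assms] by (auto simp: fun_eq_iff)
next
  assume f: "f = 0"
  have "trunc_norm (0 :: nat \<Rightarrow> 'a) \<le> 0 + 0"
    by (rule trunc_normI(2)) (simp_all add: exceed_zero)
  then show "trunc_norm f = 0" using trunc_norm_nonneg[OF assms] f by simp
qed

lemma trunc_norm_zero [simp]: "trunc_norm 0 = 0"
  by (simp add: trunc_norm_eq_0_iff zero_in_trunc_space)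

lemma level_size_scale:
  assumes "c \<noteq> 0"
  shows "exceed (seq_scale c f) t = exceed f (t / norm c)"
    and "level_size (seq_scale c f) t = norm c * level_size f (t / norm c)"
proof -
  show e: "exceed (seq_scale c f) t = exceed f (t / norm c)"
    using assms by (auto simp: exceed_def seq_scale_def norm_mult field_simps)
  have "sum (seq_scale c f) F = c * sum f F" for F :: "nat set"
    by (simp add: seq_scale_def sum_distrib_left)
  then show "level_size (seq_scale c f) t = norm c * level_size f (t / norm c)"
    using assms unfolding level_size_def e by (simp add: norm_mult algebra_simps)
qed

lemma seq_scale_0 [simp]: "seq_scale 0 f = 0"
  by (simp add: seq_scale_def fun_eq_iff)

lemma trunc_norm_scale_le:
  assumes "f \<in> trunc_space"
  shows "seq_scale c f \<in> trunc_space" and "trunc_norm (seq_scale c f) \<le> norm c * trunc_norm f"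
proof -
  have "seq_scale c f \<in> trunc_space \<and> trunc_norm (seq_scale c f) \<le> norm c * trunc_norm f"
  proof (cases "c = 0")
    case True
    then show ?thesis by (simp add: zero_in_trunc_space)
  next
    case False
    have le: "level_size (seq_scale c f) t \<le> norm c * trunc_norm f" if "0 < t" for t
      unfolding level_size_scale[OF False]
      using level_size_le[OF assms] that False by (intro mult_left_mono) auto
    have "bdd_above (level_size (seq_scale c f) ` {0<..})"
      using le by (intro bdd_aboveI2) auto
    moreover have "trunc_norm (seq_scale c f) \<le> norm c * trunc_norm f"
      unfolding trunc_norm_def[of "seq_scale c f"] using le by (intro cSUP_least) auto
    ultimately show ?thesis
      using finite_exceed[OF assms] False by (simp add: trunc_space_def level_size_scale)
  qed
  then show "seq_scale c f \<in> trunc_space" "trunc_norm (seq_scale c f) \<le> norm c * trunc_norm f"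
    by auto
qed

lemma trunc_norm_scale:
  assumes "f \<in> trunc_space"
  shows "trunc_norm (seq_scale c f) = norm c * trunc_norm f"
proof (cases "c = 0")
  case True
  then show ?thesis by (simp add: zero_in_trunc_space)
next
  case False
  have "seq_scale (inverse c) (seq_scale c f) = f"
    using False by (simp add: seq_scale_def fun_eq_iff)
  then have "trunc_norm f \<le> norm (inverse c) * trunc_norm (seq_scale c f)"
    using trunc_norm_scale_le[OF trunc_norm_scale_le(1)[OF assms], of "inverse c" c] by simp
  then have "norm c * trunc_norm f \<le> trunc_norm (seq_scale c f)"
    using False by (simp add: norm_inverse norm_divide field_simps)
  then show ?thesis using trunc_norm_scale_le(2)[OF assms, of c] by linarith
qed

text \<open>
  If \<open>|f n| \<le> t/2\<close> and \<open>|g n| \<le> t/2\<close> then \<open>|f n + g n| \<le> t\<close>. So the union \<open>F\<close> of the level sets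
  of \<open>f\<close> and \<open>g\<close> at \<open>t/2\<close> contains the level sets at \<open>t\<close> of \<open>f\<close>, \<open>g\<close> and \<open>f + g\<close>, and the three
  sums can be compared on \<open>F\<close>.
\<close>

lemma trunc_norm_triangle:
  assumes f: "f \<in> trunc_space" and g: "g \<in> trunc_space"
  shows "f + g \<in> trunc_space" and "trunc_norm (f + g) \<le> 9 * (trunc_norm f + trunc_norm g)"
proof -
  let ?M = "trunc_norm f + trunc_norm g"
  have *: "finite (exceed (f + g) t)" "t * card (exceed (f + g) t) \<le> 2 * ?M"
    "norm (sum (f + g) (exceed (f + g) t)) \<le> 7 * ?M" if t: "0 < t" for t
  proof -
    define F where "F = exceed f (t/2) \<union> exceed g (t/2)"
    have fin: "finite F" using finite_exceed[OF f] finite_exceed[OF g] t by (simp add: F_def)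
    have "card F \<le> card (exceed f (t/2)) + card (exceed g (t/2))"
      unfolding F_def by (rule card_Un_le)
    then have "t/2 * card F \<le> t/2 * (card (exceed f (t/2)) + card (exceed g (t/2)))"
      using t by (intro mult_left_mono) (simp_all only: of_nat_le_iff)
    then have card: "t * card F \<le> 2 * ?M"
      using card_exceed_le[OF f, of "t/2"] card_exceed_le[OF g, of "t/2"] t
      by (simp add: algebra_simps)
    have "norm (f n + g n) \<le> t" if "norm (f n) \<le> t/2" "norm (g n) \<le> t/2" for n
      using that norm_triangle_ineq[of "f n" "g n"] by linarith
    then have sub: "exceed (f + g) t \<subseteq> F"
      by (fastforce simp: exceed_def F_def not_less[symmetric])
    have subs: "exceed f t \<subseteq> F" "exceed g t \<subseteq> F" using t by (auto simp: exceed_def F_def)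
    show "finite (exceed (f + g) t)" using sub fin by (rule finite_subset)
    have "t * card (exceed (f + g) t) \<le> t * card F"
      using sub fin t by (intro mult_left_mono) (auto intro: card_mono)
    then show "t * card (exceed (f + g) t) \<le> 2 * ?M" using card by linarith
    have "norm (sum (f + g) F) \<le> norm (sum f F) + norm (sum g F)"
      by (simp add: sum.distrib norm_triangle_ineq)
    then have "norm (sum (f + g) F) \<le> 5 * ?M"
      using norm_sum_le_of_exceed_subset[OF f subs(1) fin t]
        norm_sum_le_of_exceed_subset[OF g subs(2) fin t] card by argo
    then show "norm (sum (f + g) (exceed (f + g) t)) \<le> 7 * ?M"
      using norm_sum_diff_exceed_le[OF sub fin] t card
        norm_triangle_sub[of "sum (f + g) (exceed (f + g) t)" "sum (f + g) F"]
      by (simp add: norm_minus_commute)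
  qed
  show "f + g \<in> trunc_space" by (rule trunc_normI(1)) (fact *)+
  have "trunc_norm (f + g) \<le> 2 * ?M + 7 * ?M" by (rule trunc_normI(2)) (fact *)+
  then show "trunc_norm (f + g) \<le> 9 * ?M" by linarith
qed

lemma uminus_eq_seq_scale: "- f = seq_scale (- 1) f"
  by (simp add: seq_scale_def fun_eq_iff)

lemma trunc_norm_diff:
  assumes f: "f \<in> trunc_space" and g: "g \<in> trunc_space"
  shows "f - g \<in> trunc_space" and "trunc_norm (f - g) \<le> 9 * (trunc_norm f + trunc_norm g)"
    and "trunc_norm (g - f) = trunc_norm (f - g)"
proof -
  have m: "- h \<in> trunc_space" "trunc_norm (- h) = trunc_norm h" if "h \<in> trunc_space"
    for h :: "nat \<Rightarrow> 'a"
    unfolding uminus_eq_seq_scale using that by (simp_all add: trunc_norm_scale_le trunc_norm_scale)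
  show *: "f - g \<in> trunc_space" "trunc_norm (f - g) \<le> 9 * (trunc_norm f + trunc_norm g)"
    using trunc_norm_triangle[OF f m(1)[OF g]] m(2)[OF g] by simp_all
  show "trunc_norm (g - f) = trunc_norm (f - g)" using m(2)[OF *(1)] by simp
qed

section \<open>Completeness\<close>

text \<open>
  A substitute for lower semicontinuity of the quasi-norm. Sums over level sets do not pass to
  pointwise limits, because part of a level set may escape to infinity. But for fixed \<open>t\<close> a
  uniform approximation of \<open>f\<close> by \<open>u m\<close> up to \<open>t/2\<close> puts the level set of \<open>x - f\<close> at \<open>t\<close> into
  that of \<open>x - u m\<close> at \<open>t/2\<close>, where \<open>trunc_norm (x - u m)\<close> controls both terms.
\<close>

lemma trunc_norm_limit_le:
  assumes x: "x \<in> trunc_space" and "\<And>m. u m \<in> trunc_space"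
    and unif: "\<And>e. 0 < e \<Longrightarrow> \<exists>m\<ge>M. \<forall>n. norm (u m n - f n) \<le> e"
    and small: "\<And>m. m \<ge> M \<Longrightarrow> trunc_norm (x - u m) \<le> e"
  shows "x - f \<in> trunc_space" and "trunc_norm (x - f) \<le> 7 * e"
proof -
  have *: "finite (exceed (x - f) t)" "t * card (exceed (x - f) t) \<le> 2 * e"
    "norm (sum (x - f) (exceed (x - f) t)) \<le> 5 * e" if t: "0 < t" for t
  proof -
    obtain m where m: "m \<ge> M" "\<And>n. norm (u m n - f n) \<le> t/2" using unif[of "t/2"] t by auto
    define h where "h = x - u m"
    define F where "F = exceed h (t/2)"
    have h: "h \<in> trunc_space" unfolding h_def using assms(1,2) by (rule trunc_norm_diff)
    have he: "trunc_norm h \<le> e" unfolding h_def by (rule small[OF m(1)])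
    have fin: "finite F" unfolding F_def using finite_exceed[OF h] t by simp
    have card: "t * card F \<le> 2 * e"
      using card_exceed_le[OF h, of "t/2"] t he by (simp add: F_def)
    have d: "x - f = h + (u m - f)" by (simp add: h_def)
    have "norm (x n - f n) \<le> t" if "norm (h n) \<le> t/2" for n
      using norm_triangle_ineq[of "h n" "u m n - f n"] that m(2)[of n] by (simp add: h_def)
    then have sub: "exceed (x - f) t \<subseteq> F"
      by (fastforce simp: exceed_def F_def not_less[symmetric])
    show "finite (exceed (x - f) t)" using sub fin by (rule finite_subset)
    have "t * card (exceed (x - f) t) \<le> t * card F"
      using sub fin t by (intro mult_left_mono) (auto intro: card_mono)
    then show "t * card (exceed (x - f) t) \<le> 2 * e" using card by linarith
    have "sum (x - f) F = sum h F + sum (u m - f) F"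
      unfolding d by (simp add: sum.distrib)
    then have "norm (sum (x - f) F) \<le> norm (sum h F) + norm (sum (u m - f) F)"
      by (simp add: norm_triangle_ineq)
    moreover have "norm (sum h F) \<le> 2 * e"
      using norm_sum_exceed_le[OF h, of "t/2"] t he trunc_norm_nonneg[OF h] by (simp add: F_def)
    moreover have "norm (sum (u m - f) F) \<le> t/2 * card F"
      using m(2) fin t by (intro norm_sum_small_le) auto
    ultimately have "norm (sum (x - f) F) \<le> 3 * e" using card by simp
    then show "norm (sum (x - f) (exceed (x - f) t)) \<le> 5 * e"
      using norm_sum_diff_exceed_le[OF sub fin] t card
        norm_triangle_sub[of "sum (x - f) (exceed (x - f) t)" "sum (x - f) F"]
      by (simp add: norm_minus_commute)
  qed
  show "x - f \<in> trunc_space" by (rule trunc_normI(1)) (fact *)+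
  have "trunc_norm (x - f) \<le> 2 * e + 5 * e" by (rule trunc_normI(2)) (fact *)+
  then show "trunc_norm (x - f) \<le> 7 * e" by linarith
qed

text \<open>
  The closure of the finitely supported sequences in \<open>trunc_space\<close>. It is a proper subspace, as
  it is for weak \<open>l\<^sub>1\<close>, so the unit vectors are complete only after this restriction.
\<close>

definition finitary_closure :: "(nat \<Rightarrow> 'k::real_normed_field) set" where
  "finitary_closure = {f \<in> trunc_space. \<forall>\<epsilon>>0. \<exists>g. finite {n. g n \<noteq> 0} \<and> trunc_norm (f - g) < \<epsilon>}"

lemma finite_support_in_trunc_space:
  assumes "finite {n. f n \<noteq> 0}"
  shows "f \<in> trunc_space"
proof -
  define S where "S = {n. f n \<noteq> 0}"
  define b where "b = (\<Sum>n\<in>S. norm (f n))"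
  have sub: "exceed f t \<subseteq> S" if "0 < t" for t using that by (auto simp: exceed_def S_def)
  have S: "finite S" using assms by (simp add: S_def)
  have sum: "(\<Sum>n\<in>exceed f t. norm (f n)) \<le> b" if "0 < t" for t
    unfolding b_def using sub[OF that] S by (intro sum_mono2) auto
  show ?thesis
  proof (rule trunc_normI(1))
    fix t :: real assume t: "0 < t"
    show "finite (exceed f t)" using sub[OF t] S by (rule finite_subset)
    have "t * card (exceed f t) = (\<Sum>n\<in>exceed f t. t)" by simp
    also have "\<dots> \<le> (\<Sum>n\<in>exceed f t. norm (f n))" by (rule sum_mono) (simp add: exceed_def)
    finally show "t * card (exceed f t) \<le> b" using sum[OF t] by linarith
    show "norm (sum f (exceed f t)) \<le> b" using norm_sum sum[OF t] by (rule order_trans)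
  qed
qed

lemma finite_support_in_finitary_closure:
  assumes "finite {n. f n \<noteq> 0}"
  shows "f \<in> finitary_closure"
proof -
  have "trunc_norm (f - f) = 0" by simp
  then show ?thesis
    using assms finite_support_in_trunc_space[OF assms] unfolding finitary_closure_def by fastforce
qed

lemma finitary_closure_subset: "finitary_closure \<subseteq> trunc_space"
  by (auto simp: finitary_closure_def)

lemma finitary_closure_approx:
  assumes "f \<in> finitary_closure" "0 < \<epsilon>"
  obtains g where "finite {n. g n \<noteq> 0}" "g \<in> trunc_space" "trunc_norm (f - g) < \<epsilon>"
  using assms finite_support_in_trunc_space unfolding finitary_closure_def by blast

lemma finitary_closure_closed:
  assumes "f \<in> trunc_space" "\<And>\<epsilon>. 0 < \<epsilon> \<Longrightarrow> \<exists>h\<in>finitary_closure. trunc_norm (f - h) < \<epsilon>"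
  shows "f \<in> finitary_closure"
proof -
  have "\<exists>g. finite {n. g n \<noteq> 0} \<and> trunc_norm (f - g) < \<epsilon>" if e: "0 < \<epsilon>" for \<epsilon>
  proof -
    \<comment> \<open>\<open>18 = 2 * 9\<close>: two summands and the constant of the quasi-triangle inequality.\<close>
    obtain h where h: "h \<in> finitary_closure" "trunc_norm (f - h) < \<epsilon> / 18"
      using assms(2)[of "\<epsilon> / 18"] e by force
    obtain g where g: "finite {n. g n \<noteq> 0}" "g \<in> trunc_space" "trunc_norm (h - g) < \<epsilon> / 18"
      using finitary_closure_approx[OF h(1), of "\<epsilon> / 18"] e by auto
    have "h \<in> trunc_space" using h(1) finitary_closure_subset by blast
    then have "trunc_norm ((f - h) + (h - g)) \<le> 9 * (trunc_norm (f - h) + trunc_norm (h - g))"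
      using assms(1) g(2) by (intro trunc_norm_triangle trunc_norm_diff)
    then show ?thesis using g h(2) by (auto simp: intro!: exI[of _ g])
  qed
  then show ?thesis using assms(1) by (simp add: finitary_closure_def)
qed

lemma finitary_closure_add:
  assumes f: "f \<in> finitary_closure" and g: "g \<in> finitary_closure"
  shows "f + g \<in> finitary_closure"
proof (rule finitary_closure_closed)
  have fg: "f \<in> trunc_space" "g \<in> trunc_space" using f g finitary_closure_subset by auto
  then show "f + g \<in> trunc_space" by (rule trunc_norm_triangle)
  fix \<epsilon> :: real assume "0 < \<epsilon>"
  then have e: "0 < \<epsilon> / 18" by simp
  obtain f' where f': "finite {n. f' n \<noteq> 0}" "f' \<in> trunc_space" "trunc_norm (f - f') < \<epsilon> / 18"
    using finitary_closure_approx[OF f e] .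
  obtain g' where g': "finite {n. g' n \<noteq> 0}" "g' \<in> trunc_space" "trunc_norm (g - g') < \<epsilon> / 18"
    using finitary_closure_approx[OF g e] .
  have "{n. (f' + g') n \<noteq> 0} \<subseteq> {n. f' n \<noteq> 0} \<union> {n. g' n \<noteq> 0}" by auto
  then have "f' + g' \<in> finitary_closure"
    using f'(1) g'(1) by (intro finite_support_in_finitary_closure) (meson finite_UnI finite_subset)
  moreover have "trunc_norm ((f - f') + (g - g')) \<le> 9 * (trunc_norm (f - f') + trunc_norm (g - g'))"
    using fg f'(2) g'(2) by (intro trunc_norm_triangle trunc_norm_diff)
  then have "trunc_norm ((f + g) - (f' + g')) < \<epsilon>"
    using f'(3) g'(3) by (simp add: algebra_simps)
  ultimately show "\<exists>h\<in>finitary_closure. trunc_norm (f + g - h) < \<epsilon>" by blast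
qed

lemma finitary_closure_scale:
  assumes f: "f \<in> finitary_closure"
  shows "seq_scale c f \<in> finitary_closure"
proof (rule finitary_closure_closed)
  have ft: "f \<in> trunc_space" using f finitary_closure_subset by auto
  then show "seq_scale c f \<in> trunc_space" by (rule trunc_norm_scale_le)
  fix \<epsilon> :: real assume e: "0 < \<epsilon>"
  have "0 < \<epsilon> / (norm c + 1)" using e by (intro divide_pos_pos) (auto intro: add_nonneg_pos)
  then obtain g where g: "finite {n. g n \<noteq> 0}" "g \<in> trunc_space"
    "trunc_norm (f - g) < \<epsilon> / (norm c + 1)"
    using finitary_closure_approx[OF f] by blast
  have "{n. seq_scale c g n \<noteq> 0} \<subseteq> {n. g n \<noteq> 0}" by (auto simp: seq_scale_def)
  then have "seq_scale c g \<in> finitary_closure"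
    using g(1) by (intro finite_support_in_finitary_closure) (meson finite_subset)
  moreover have "trunc_norm (seq_scale c f - seq_scale c g) < \<epsilon>"
  proof -
    have "seq_scale c f - seq_scale c g = seq_scale c (f - g)"
      by (simp add: seq_scale_def fun_eq_iff algebra_simps)
    then have "trunc_norm (seq_scale c f - seq_scale c g) = norm c * trunc_norm (f - g)"
      using trunc_norm_scale trunc_norm_diff(1)[OF ft g(2)] by simp
    also have "\<dots> \<le> (norm c + 1) * trunc_norm (f - g)"
      using trunc_norm_nonneg[OF trunc_norm_diff(1)[OF ft g(2)]] by (simp add: algebra_simps)
    also have "\<dots> < \<epsilon>"
      using g(3) by (simp add: pos_less_divide_eq add_nonneg_pos mult.commute)
    finally show ?thesis .
  qed
  ultimately show "\<exists>h\<in>finitary_closure. trunc_norm (seq_scale c f - h) < \<epsilon>" by blast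
qed

interpretation trunc: quasi_normed_space
  "seq_scale :: 'k::real_normed_field \<Rightarrow> _" "finitary_closure" "trunc_norm"
proof -
  interpret vs: vector_space "seq_scale :: 'k \<Rightarrow> _" by (rule vector_space_seq_scale)
  show "quasi_normed_space (seq_scale :: 'k \<Rightarrow> _) finitary_closure trunc_norm"
  proof
    show "vs.subspace finitary_closure"
      by (rule vs.subspaceI)
        (auto intro: finitary_closure_add finitary_closure_scale finite_support_in_finitary_closure)
    show "\<exists>\<kappa>. \<forall>f\<in>finitary_closure. \<forall>g\<in>finitary_closure.
        trunc_norm (f + g) \<le> \<kappa> * (trunc_norm f + trunc_norm g)"
      using trunc_norm_triangle(2) finitary_closure_subset by blast
  qed (use finitary_closure_subset in \<open>auto intro: trunc_norm_nonneg
      simp: trunc_norm_eq_0_iff trunc_norm_scale subset_iff\<close>)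
qed

interpretation trunc: quasi_banach_space
  "seq_scale :: 'k::{real_normed_field,banach} \<Rightarrow> _" "finitary_closure" "trunc_norm"
proof
  fix u :: "nat \<Rightarrow> nat \<Rightarrow> 'k"
  assume u: "range u \<subseteq> finitary_closure" and "trunc.cauchy_seq u"
  then have C: "\<exists>M. \<forall>m\<ge>M. \<forall>n\<ge>M. trunc_norm (u m - u n) < \<epsilon>" if "0 < \<epsilon>" for \<epsilon>
    using that unfolding trunc.cauchy_seq_def by blast
  have ut: "u m \<in> trunc_space" for m using u finitary_closure_subset by auto
  have coord: "norm (u m i - u n i) \<le> trunc_norm (u m - u n)" for m n i
    using norm_coord_le[OF trunc_norm_diff(1)[OF ut ut], of m n i] by simp
  define f where "f i = lim (\<lambda>m. u m i)" for i
  have lim: "(\<lambda>m. u m i) \<longlonglongrightarrow> f i" for i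
  proof -
    have "Cauchy (\<lambda>m. u m i)"
      unfolding Cauchy_def dist_norm using C coord by (meson le_less_trans)
    then show ?thesis unfolding f_def by (simp add: Cauchy_convergent convergent_LIMSEQ_iff[symmetric])
  qed
  have unif: "\<exists>m\<ge>M. \<forall>i. norm (u m i - f i) \<le> e" if "0 < e" for e M
  proof -
    obtain K where K: "\<And>m n. m \<ge> K \<Longrightarrow> n \<ge> K \<Longrightarrow> trunc_norm (u m - u n) < e"
      using C[OF \<open>0 < e\<close>] by blast
    let ?m = "max M K"
    have "norm (u ?m i - f i) \<le> e" for i
    proof (rule LIMSEQ_le_const2)
      show "(\<lambda>n. norm (u ?m i - u n i)) \<longlonglongrightarrow> norm (u ?m i - f i)"
        by (intro tendsto_intros lim)
      show "\<exists>N. \<forall>n\<ge>N. norm (u ?m i - u n i) \<le> e"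
        using K[of ?m] coord[of ?m i] by (meson less_imp_le max.cobounded2 order_trans)
    qed
    then show ?thesis by (intro exI[of _ ?m]) auto
  qed
  have near: "\<exists>M. \<forall>m\<ge>M. u m - f \<in> trunc_space \<and> trunc_norm (u m - f) \<le> e" if "0 < e" for e
  proof -
    obtain M where M: "\<And>m n. m \<ge> M \<Longrightarrow> n \<ge> M \<Longrightarrow> trunc_norm (u m - u n) < e / 7"
      using C[of "e / 7"] \<open>0 < e\<close> by auto
    have "u m - f \<in> trunc_space \<and> trunc_norm (u m - f) \<le> 7 * (e / 7)" if "m \<ge> M" for m
      using M[OF that] by (intro conjI trunc_norm_limit_le[where M = M and u = u] ut unif less_imp_le)
    then show ?thesis by auto
  qed
  obtain M where "u M - f \<in> trunc_space" using near[OF zero_less_one] by blast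
  then have "u M - (u M - f) \<in> trunc_space" by (rule trunc_norm_diff(1)[OF ut])
  then have ft: "f \<in> trunc_space" by simp
  have "f \<in> finitary_closure"
  proof (rule finitary_closure_closed[OF ft])
    fix \<epsilon> :: real assume "0 < \<epsilon>"
    then obtain M where "trunc_norm (u M - f) \<le> \<epsilon> / 2" using near[of "\<epsilon> / 2"] by auto
    then show "\<exists>h\<in>finitary_closure. trunc_norm (f - h) < \<epsilon>"
      using trunc_norm_diff(3)[OF ft ut, of M] u \<open>0 < \<epsilon>\<close> by (intro bexI[of _ "u M"]) auto
  qed
  moreover have "trunc.converges_to u f"
    unfolding trunc.converges_to_def
  proof (rule LIMSEQ_I)
    fix r :: real assume "0 < r"
    then obtain M where M: "\<And>m. m \<ge> M \<Longrightarrow> u m - f \<in> trunc_space \<and> trunc_norm (u m - f) \<le> r / 2"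
      using near[of "r / 2"] by auto
    then show "\<exists>no. \<forall>m\<ge>no. norm (trunc_norm (u m - f) - 0) < r"
      using \<open>0 < r\<close> trunc_norm_nonneg by (intro exI[of _ M]) fastforce
  qed
  ultimately show "\<exists>f\<in>finitary_closure. trunc.converges_to u f" by blast
qed

section \<open>The unit vectors\<close>

definition unit_seq :: "nat \<Rightarrow> nat \<Rightarrow> 'k::real_normed_field" where
  "unit_seq k = (\<lambda>n. if n = k then 1 else 0)"

lemma sum_fun_apply: "(\<Sum>a\<in>A. g a) x = (\<Sum>a\<in>A. g a x)"
  by (induction A rule: infinite_finite_induct) auto

lemma sum_scale_unit_seq:
  assumes "finite A" "inj p"
  shows "(\<Sum>n\<in>A. seq_scale (a n) (unit_seq (p n))) (p k) = (if k \<in> A then a k else 0)"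
proof -
  have "(\<Sum>n\<in>A. seq_scale (a n) (unit_seq (p n))) (p k) = (\<Sum>n\<in>A. if n = k then a n else 0)"
    unfolding sum_fun_apply using assms(2)
    by (intro sum.cong) (auto simp: seq_scale_def unit_seq_def inj_eq)
  then show ?thesis using assms(1) by simp
qed

lemma coord_proj_unit_seq:
  assumes "finite A"
  shows "trunc.coord_proj unit_seq (\<lambda>n f. f n) A f = (\<lambda>n. if n \<in> A then f n else 0)"
  using sum_scale_unit_seq[OF assms inj_on_id2, of f]
  by (auto simp: trunc.coord_proj_def fun_eq_iff)

lemma finite_support_in_span_unit_seq:
  assumes "finite {n. f n \<noteq> 0}"
  shows "f \<in> trunc.span (range unit_seq)"
proof -
  have "(\<Sum>n\<in>{n. f n \<noteq> 0}. seq_scale (f n) (unit_seq n)) = f"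
    using sum_scale_unit_seq[OF assms inj_on_id2, of f] by (auto simp: fun_eq_iff)
  moreover have "(\<Sum>n\<in>{n. f n \<noteq> 0}. seq_scale (f n) (unit_seq n)) \<in> trunc.span (range unit_seq)"
    by (intro trunc.span_sum trunc.span_scale trunc.span_base rangeI)
  ultimately show ?thesis by simp
qed

lemma unit_seq_in_finitary_closure: "unit_seq k \<in> finitary_closure"
  by (rule finite_support_in_finitary_closure) (simp add: unit_seq_def)

lemma trunc_norm_unit_seq:
  shows "1 \<le> trunc_norm (unit_seq k :: nat \<Rightarrow> 'k::real_normed_field)"
    and "trunc_norm (unit_seq k :: nat \<Rightarrow> 'k) \<le> 2"
proof -
  have e: "exceed (unit_seq k :: nat \<Rightarrow> 'k) t = (if t < 1 then {k} else {})" if "0 < t" for t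
    using that by (auto simp: exceed_def unit_seq_def)
  have "trunc_norm (unit_seq k :: nat \<Rightarrow> 'k) \<le> 1 + 1"
    by (rule trunc_normI(2)) (auto simp: e, auto simp: unit_seq_def)
  then show "trunc_norm (unit_seq k :: nat \<Rightarrow> 'k) \<le> 2" by simp
  show "1 \<le> trunc_norm (unit_seq k :: nat \<Rightarrow> 'k)"
    using norm_coord_le[of "unit_seq k :: nat \<Rightarrow> 'k" k]
      unit_seq_in_finitary_closure finitary_closure_subset
    by (auto simp: unit_seq_def)
qed

lemma biorthogonal_unit_seq: "trunc.biorthogonal unit_seq (\<lambda>n f. f n)"
proof -
  have "(\<lambda>f. f n) \<in> trunc.dual" for n
    unfolding trunc.dual_def using finitary_closure_subset
    by (auto simp: seq_scale_def intro!: exI[of _ 1] norm_coord_le)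
  then show ?thesis
    by (auto simp: trunc.biorthogonal_def unit_seq_in_finitary_closure) (auto simp: unit_seq_def)
qed

lemma closed_span_unit_seq:
  "trunc.closed_span (range (unit_seq :: nat \<Rightarrow> nat \<Rightarrow> 'k::real_normed_field)) = finitary_closure"
proof
  let ?E = "range (unit_seq :: nat \<Rightarrow> nat \<Rightarrow> 'k)"
  show "trunc.closed_span ?E \<subseteq> finitary_closure" by (auto simp: trunc.closed_span_def)
  show "finitary_closure \<subseteq> trunc.closed_span ?E"
  proof
    fix f :: "nat \<Rightarrow> 'k" assume f: "f \<in> finitary_closure"
    then have ft: "f \<in> trunc_space" using finitary_closure_subset by auto
    have "\<exists>g. finite {n. g n \<noteq> 0} \<and> g \<in> trunc_space \<and> trunc_norm (f - g) < inverse (Suc m)" for m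
    proof -
      have "0 < inverse (real (Suc m))" by simp
      then show ?thesis using finitary_closure_approx[OF f] by blast
    qed
    then obtain u where u: "\<And>m. finite {n. u m n \<noteq> 0}" "\<And>m. u m \<in> trunc_space"
      "\<And>m. trunc_norm (f - u m) < inverse (Suc m)" by metis
    have "trunc.converges_to u f"
      unfolding trunc.converges_to_def
    proof (rule tendsto_sandwich[OF _ _ tendsto_const LIMSEQ_inverse_real_of_nat])
      show "\<forall>\<^sub>F m in sequentially. 0 \<le> trunc_norm (u m - f)"
        by (intro always_eventually allI trunc_norm_nonneg trunc_norm_diff(1) u(2) ft)
      show "\<forall>\<^sub>F m in sequentially. trunc_norm (u m - f) \<le> inverse (Suc m)"
        using u(3)
        by (intro always_eventually allI less_imp_le) (simp add: trunc_norm_diff(3)[OF ft u(2)])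
    qed
    moreover have "range u \<subseteq> trunc.span ?E"
      using finite_support_in_span_unit_seq[OF u(1)] by blast
    ultimately show "f \<in> trunc.closed_span ?E"
      using f by (auto simp: trunc.closed_span_def)
  qed
qed

lemma W_basis_unit_seq: "trunc.W_basis (unit_seq :: nat \<Rightarrow> nat \<Rightarrow> 'k::real_normed_field) (\<lambda>n f. f n)"
proof -
  let ?e = "unit_seq :: nat \<Rightarrow> nat \<Rightarrow> 'k"
  have dual: "trunc.dual_norm (\<lambda>f :: nat \<Rightarrow> 'k. f n) \<le> 1" for n
    unfolding trunc.dual_norm_def
  proof (intro cSUP_least)
    show "{f :: nat \<Rightarrow> 'k. f \<in> finitary_closure \<and> trunc_norm f \<le> 1} \<noteq> {}"
      using finite_support_in_finitary_closure[of "0 :: nat \<Rightarrow> 'k"] by (auto intro!: exI[of _ 0])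
    fix f :: "nat \<Rightarrow> 'k" assume "f \<in> {f \<in> finitary_closure. trunc_norm f \<le> 1}"
    then show "norm (f n) \<le> 1" using norm_coord_le[of f n] finitary_closure_subset by auto
  qed
  have "trunc_norm (?e n) * trunc.dual_norm (\<lambda>f :: nat \<Rightarrow> 'k. f n) \<le> 2" for n
  proof -
    have "trunc_norm (?e n) * trunc.dual_norm (\<lambda>f :: nat \<Rightarrow> 'k. f n) \<le> trunc_norm (?e n) * 1"
      using dual trunc_norm_unit_seq(1)[of n, where 'k = 'k] by (intro mult_left_mono) auto
    then show ?thesis using trunc_norm_unit_seq(2)[of n, where 'k = 'k] by linarith
  qed
  moreover have "1 \<le> (INF n. trunc_norm (?e n))"
    using trunc_norm_unit_seq(1) by (intro cINF_greatest) auto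
  ultimately show ?thesis
    unfolding trunc.W_basis_def
    using biorthogonal_unit_seq closed_span_unit_seq trunc_norm_unit_seq(2)
    by (auto intro!: bdd_aboveI2)
qed

section \<open>Greedy sums\<close>

text \<open>
  If \<open>A \<subseteq> B\<close> then \<open>A = B\<close>. Otherwise let \<open>s\<close> be the least modulus of an entry of \<open>f\<close> on \<open>A - B\<close>.
  Nothing outside \<open>A\<close> exceeds \<open>s\<close>, so only levels \<open>t < s\<close> matter for \<open>g\<close>, and at such a level
  the level sets of \<open>g\<close> and \<open>h\<close> differ only by exchanging \<open>A - B\<close> for a part of \<open>B - A\<close>, which
  is not larger. All of \<open>A - B\<close> lies in the level sets of \<open>h\<close> below \<open>s\<close>, so \<open>s * card (A - B)\<close>
  is controlled by the quasi-norm of \<open>h\<close>. This bounds the sum over the part of \<open>B - A\<close>, where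
  entries have modulus at most \<open>s\<close>. The sum over \<open>A - B\<close>, whose entries may be large, is the sum
  of \<open>h\<close> over its level set at \<open>s\<close> up to ties of modulus \<open>s\<close>.
\<close>

lemma trunc_norm_greedy_le:
  fixes f :: "nat \<Rightarrow> 'k::real_normed_field"
  assumes A: "finite A" "\<And>n k. n \<in> A \<Longrightarrow> k \<notin> A \<Longrightarrow> norm (f k) \<le> norm (f n)"
    and B: "finite B" "card B \<le> card A"
    and g: "g = (\<lambda>n. if n \<in> A then 0 else f n)" and h: "h = (\<lambda>n. if n \<in> B then 0 else f n)"
    and ht: "h \<in> trunc_space"
  shows "trunc_norm g \<le> 7 * trunc_norm h"
proof (cases "A \<subseteq> B")
  case True
  then have "A = B" using B by (intro card_seteq)
  then show ?thesis using g h trunc_norm_nonneg[OF ht] by simp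
next
  case False
  define D where "D = A - B"
  define s where "s = Min ((\<lambda>n. norm (f n)) ` D)"
  have D: "finite D" "D \<noteq> {}" using A(1) False by (auto simp: D_def)
  then have "s \<in> (\<lambda>n. norm (f n)) ` D" unfolding s_def by (intro Min_in) auto
  then obtain p where p: "p \<in> D" "s = norm (f p)" by auto
  have s_le: "s \<le> norm (f n)" if "n \<in> D" for n using D that by (simp add: s_def)
  have le_s: "norm (f k) \<le> s" if "k \<notin> A" for k using A(2)[OF _ that] p by (simp add: D_def)
  have "card (B - A) + card (A \<inter> B) \<le> card D + card (A \<inter> B)"
    using B A(1) card_Int_Diff[of A B] card_Int_Diff[of B A] by (simp add: D_def Int_commute)
  then have cBA: "card (B - A) \<le> card D" by simp
  have *: "finite (exceed g t)" "t * card (exceed g t) \<le> trunc_norm h"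
    "norm (sum g (exceed g t)) \<le> 6 * trunc_norm h" if t: "0 < t" for t
  proof -
    have "finite (exceed g t) \<and> t * card (exceed g t) \<le> trunc_norm h
      \<and> norm (sum g (exceed g t)) \<le> 6 * trunc_norm h"
    proof (cases "s \<le> t")
      case True
      have "norm (g n) \<le> t" for n using le_s[of n] True t by (cases "n \<in> A") (simp_all add: g)
      then have "exceed g t = {}" by (simp add: exceed_def not_less)
      then show ?thesis using trunc_norm_nonneg[OF ht] by simp
    next
      case False
      define E where "E = {n \<in> B - A. t < norm (f n)}"
      have s: "0 < s" using False t by simp
      have Dh: "D \<subseteq> exceed h r" if "r < s" for r
        using less_le_trans[OF that s_le] by (auto simp: exceed_def h D_def)
      have "s / 2 * card D \<le> s / 2 * card (exceed h (s / 2))"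
        using s Dh[of "s / 2"] finite_exceed[OF ht] by (intro mult_left_mono) (auto intro: card_mono)
      then have sD: "s * card D \<le> 2 * trunc_norm h"
        using card_exceed_le[OF ht, of "s / 2"] s by linarith
      have Dt: "D \<subseteq> exceed h t" using Dh False by simp
      have fin: "finite (exceed h t)" using ht t by (rule finite_exceed)
      have "E \<subseteq> B - A" by (auto simp: E_def)
      then have E: "finite E" "card E \<le> card D"
        using B(1) cBA card_mono[of "B - A" E] by (auto intro: finite_subset)
      have eq: "exceed g t = (exceed h t - D) \<union> E" and disj: "(exceed h t - D) \<inter> E = {}"
        using t by (auto simp: exceed_def g h D_def E_def split: if_splits)
      have "card (exceed g t) = card (exceed h t) - card D + card E"
        unfolding eq using fin E(1) disj D(1) Dt by (simp add: card_Un_disjoint card_Diff_subset)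
      also have "\<dots> \<le> card (exceed h t)" using E(2) card_mono[OF fin Dt] by simp
      finally have "t * card (exceed g t) \<le> t * card (exceed h t)"
        using t by (intro mult_left_mono) auto
      then have card: "t * card (exceed g t) \<le> trunc_norm h"
        using card_exceed_le[OF ht t] by linarith
      have "sum g (exceed g t) = sum g (exceed h t - D) + sum g E"
        unfolding eq using fin E(1) disj by (simp add: sum.union_disjoint)
      also have "sum g (exceed h t - D) = sum h (exceed h t - D)"
        using t by (intro sum.cong) (auto simp: g h D_def exceed_def)
      also have "\<dots> = sum h (exceed h t) - sum h D" using fin Dt by (simp add: sum_diff)
      finally have "sum g (exceed g t) = sum h (exceed h t) - sum h D + sum g E" .
      then have "norm (sum g (exceed g t))
          \<le> norm (sum h (exceed h t)) + norm (sum h D) + norm (sum g E)"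
        using norm_triangle_ineq[of "sum h (exceed h t) - sum h D" "sum g E"]
          norm_triangle_ineq4[of "sum h (exceed h t)" "sum h D"] by simp
      moreover have "norm (sum h (exceed h t)) \<le> trunc_norm h" using ht t by (rule norm_sum_exceed_le)
      moreover have "n \<in> D" if "n \<in> exceed h s" for n
        using that le_s[of n] s by (auto simp: exceed_def h D_def split: if_splits)
      then have "exceed h s \<subseteq> D" by blast
      then have "norm (sum h D) \<le> trunc_norm h + s * card D"
        using ht D(1) s by (intro norm_sum_le_of_exceed_subset)
      moreover have "norm (sum g E) \<le> s * card E"
        using le_s E(1) s by (intro norm_sum_small_le) (auto simp: E_def g)
      moreover have "s * card E \<le> s * card D" using E(2) s by (intro mult_left_mono) auto
      ultimately have "norm (sum g (exceed g t)) \<le> 6 * trunc_norm h" using sD by linarith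
      then show ?thesis using card eq fin E(1) by simp
    qed
    then show "finite (exceed g t)" "t * card (exceed g t) \<le> trunc_norm h"
      "norm (sum g (exceed g t)) \<le> 6 * trunc_norm h" by auto
  qed
  have "trunc_norm g \<le> trunc_norm h + 6 * trunc_norm h" by (rule trunc_normI(2)) (fact *)+
  then show ?thesis by linarith
qed

lemma almost_greedy_unit_seq:
  "trunc.almost_greedy_basis (unit_seq :: nat \<Rightarrow> nat \<Rightarrow> 'k::real_normed_field)"
proof -
  let ?P = "trunc.coord_proj (unit_seq :: nat \<Rightarrow> nat \<Rightarrow> 'k) (\<lambda>n f. f n)"
  have "trunc_norm (f - ?P A f) \<le> 7 * trunc_norm (f - ?P B f)"
    if f: "f \<in> finitary_closure" and A: "trunc.greedy_set (\<lambda>n f. f n) f A"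
      and B: "finite B" "card B \<le> card A" for f A B
  proof -
    have fA: "finite A" and gA: "\<And>n k. n \<in> A \<Longrightarrow> k \<notin> A \<Longrightarrow> norm (f k) \<le> norm (f n)"
      using A by (auto simp: trunc.greedy_set_def)
    have eq: "f - ?P F f = (\<lambda>n. if n \<in> F then 0 else f n)" if "finite F" for F
      using coord_proj_unit_seq[OF that, of f] by (auto simp: fun_eq_iff)
    have "?P B f \<in> finitary_closure"
      using B(1) by (intro finite_support_in_finitary_closure) (simp add: coord_proj_unit_seq)
    then have "f - ?P B f \<in> trunc_space"
      using f finitary_closure_subset by (intro trunc_norm_diff) auto
    then show ?thesis
      using trunc_norm_greedy_le[OF fA gA B eq[OF fA] eq[OF B(1)]] by blast
  qed
  then show ?thesis unfolding trunc.almost_greedy_basis_def using W_basis_unit_seq by blast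
qed

section \<open>Symmetry\<close>

lemma trunc_norm_permute:
  assumes "bij p"
  shows "f \<circ> p \<in> trunc_space \<longleftrightarrow> f \<in> trunc_space" and "trunc_norm (f \<circ> p) = trunc_norm f"
proof -
  have bij: "bij_betw p (exceed (f \<circ> p) t) (exceed f t)" for t
  proof (rule bij_betw_imageI)
    show "inj_on p (exceed (f \<circ> p) t)" using assms bij_is_inj inj_on_subset by blast
    show "p ` exceed (f \<circ> p) t = exceed f t"
    proof (intro set_eqI iffI)
      fix n assume "n \<in> exceed f t"
      moreover obtain k where "n = p k" using assms bij_pointE by metis
      ultimately show "n \<in> p ` exceed (f \<circ> p) t" by (auto simp: exceed_def)
    qed (auto simp: exceed_def)
  qed
  have "level_size (f \<circ> p) t = level_size f t" for t
    using sum.reindex_bij_betw[OF bij, of f t] bij_betw_same_card[OF bij, of t]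
    by (simp add: level_size_def)
  then have "level_size (f \<circ> p) = level_size f" by (rule ext)
  then show "f \<circ> p \<in> trunc_space \<longleftrightarrow> f \<in> trunc_space" "trunc_norm (f \<circ> p) = trunc_norm f"
    using bij_betw_finite[OF bij] by (simp_all add: trunc_space_def trunc_norm_def)
qed

lemma permute_in_finitary_closure:
  assumes f: "f \<in> finitary_closure" and p: "bij p"
  shows "f \<circ> p \<in> finitary_closure"
proof (rule finitary_closure_closed)
  show "f \<circ> p \<in> trunc_space" using f finitary_closure_subset trunc_norm_permute(1)[OF p] by blast
  fix \<epsilon> :: real assume "0 < \<epsilon>"
  then obtain g where g: "finite {n. g n \<noteq> 0}" "trunc_norm (f - g) < \<epsilon>"
    using finitary_closure_approx[OF f] by metis
  have "finite (p -` {n. g n \<noteq> 0})"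
    using g(1) p by (intro finite_vimageI) (auto simp: bij_def)
  then have "g \<circ> p \<in> finitary_closure"
    by (intro finite_support_in_finitary_closure) (simp add: vimage_def)
  moreover have "(f \<circ> p) - (g \<circ> p) = (f - g) \<circ> p" by (auto simp: fun_eq_iff)
  then have "trunc_norm ((f \<circ> p) - (g \<circ> p)) < \<epsilon>"
    using g(2) by (simp add: trunc_norm_permute(2)[OF p])
  ultimately show "\<exists>h\<in>finitary_closure. trunc_norm ((f \<circ> p) - h) < \<epsilon>" by blast
qed

lemma symmetric_unit_seq:
  "trunc.symmetric_system (unit_seq :: nat \<Rightarrow> nat \<Rightarrow> 'k::real_normed_field)"
proof -
  have "trunc_norm (\<Sum>n\<in>{n. a n \<noteq> 0}. seq_scale (a n) (unit_seq n))
      \<le> 1 * trunc_norm (\<Sum>n\<in>{n. a n \<noteq> 0}. seq_scale (a n) (unit_seq (\<pi> n)))"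
    if fin: "finite {n. a n \<noteq> 0}" and pi: "bij \<pi>" for a :: "nat \<Rightarrow> 'k" and \<pi> :: "nat \<Rightarrow> nat"
  proof -
    have "(\<Sum>n\<in>{n. a n \<noteq> 0}. seq_scale (a n) (unit_seq n)) = a"
      using sum_scale_unit_seq[OF fin inj_on_id2, of a] by (auto simp: fun_eq_iff)
    also have "\<dots> = (\<Sum>n\<in>{n. a n \<noteq> 0}. seq_scale (a n) (unit_seq (\<pi> n))) \<circ> \<pi>"
      using sum_scale_unit_seq[OF fin bij_is_inj[OF pi], of a] by (auto simp: fun_eq_iff)
    finally show ?thesis by (simp add: trunc_norm_permute(2)[OF pi])
  qed
  then show ?thesis
    unfolding trunc.symmetric_system_def trunc.minimal_system_def
    using biorthogonal_unit_seq by blast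
qed

section \<open>A sequence with divergent partial sums\<close>

text \<open>
  The entries \<open>1, 1/2, \<dots>, 1/m, -1, -1/2, \<dots>, -1/m\<close> placed from index \<open>b\<close> on.
\<close>

definition hump :: "nat \<Rightarrow> nat \<Rightarrow> nat \<Rightarrow> 'k::real_normed_field" where
  "hump b m = (\<lambda>n. if b \<le> n \<and> n < b + m then of_real (1 / real (n - b + 1))
     else if b + m \<le> n \<and> n < b + 2 * m then - of_real (1 / real (n - (b + m) + 1)) else 0)"

lemma hump_outside: "n < b \<or> b + 2 * m \<le> n \<Longrightarrow> hump b m n = 0"
  by (auto simp: hump_def)

lemma finite_support_hump: "finite {n. hump b m n \<noteq> 0}"
  by (rule finite_subset[of _ "{..<b + 2 * m}"]) (auto simp: hump_def split: if_splits)

text \<open>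
  Entries of equal modulus and opposite sign belong to the same level sets, so all sums over
  level sets vanish; and at most \<open>2 / t\<close> entries exceed \<open>t\<close>.
\<close>

lemma trunc_norm_hump_le: "trunc_norm (hump b m :: nat \<Rightarrow> 'k::real_normed_field) \<le> 2"
proof -
  let ?h = "hump b m :: nat \<Rightarrow> 'k"
  have *: "t * card (exceed ?h t) \<le> 2" "sum ?h (exceed ?h t) = 0" if t: "0 < t" for t
  proof -
    define K where "K = {i. i < m \<and> t < 1 / real (i + 1)}"
    have fin: "finite K" by (simp add: K_def)
    have pos: "?h (b + i) = of_real (1 / real (i + 1))"
      and neg: "?h (b + m + i) = - of_real (1 / real (i + 1))" if "i < m" for i
      using that by (simp_all add: hump_def)
    have abs: "norm (of_real (1 / real (i + 1)) :: 'k) = 1 / real (i + 1)" for i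
      unfolding norm_of_real by simp
    have eq: "exceed ?h t = (+) b ` K \<union> (+) (b + m) ` K"
    proof (intro set_eqI iffI)
      fix n assume n: "n \<in> exceed ?h t"
      then have "?h n \<noteq> 0" using t by (auto simp: exceed_def)
      then have "b \<le> n" "n < b + 2 * m" using hump_outside by (metis not_less)+
      then consider i where "n = b + i" "i < m" | i where "n = b + m + i" "i < m"
      proof (cases "n < b + m")
        case True
        then show ?thesis using that(1)[of "n - b"] \<open>b \<le> n\<close> by simp
      next
        case False
        then show ?thesis using that(2)[of "n - (b + m)"] \<open>n < b + 2 * m\<close> by simp
      qed
      then show "n \<in> (+) b ` K \<union> (+) (b + m) ` K"
      proof cases
        case 1
        then show ?thesis using n pos[of i] abs[of i] by (auto simp: exceed_def K_def)
      next
        case 2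
        then show ?thesis using n neg[of i] abs[of i] by (auto simp: exceed_def K_def)
      qed
    next
      fix n assume "n \<in> (+) b ` K \<union> (+) (b + m) ` K"
      then show "n \<in> exceed ?h t"
        using pos neg abs by (auto simp: exceed_def K_def)
    qed
    have "K \<subseteq> {..<nat \<lfloor>1 / t\<rfloor>}"
    proof
      fix i assume "i \<in> K"
      then have "real (i + 1) \<le> 1 / t" using t by (simp add: K_def field_simps)
      then have "int (i + 1) \<le> \<lfloor>1 / t\<rfloor>" by (simp add: le_floor_iff)
      then show "i \<in> {..<nat \<lfloor>1 / t\<rfloor>}" by simp
    qed
    then have "card K \<le> nat \<lfloor>1 / t\<rfloor>" using card_mono[OF finite_lessThan] by (metis card_lessThan)
    then have "real (card K) \<le> 1 / t" using t by (simp add: le_nat_iff le_floor_iff)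
    then have cK: "t * card K \<le> 1" using t by (simp add: field_simps)
    have "card (exceed ?h t) \<le> card K + card K"
      unfolding eq by (rule order_trans[OF card_Un_le]) (simp add: card_image)
    then have "t * card (exceed ?h t) \<le> t * (card K + card K)"
      using t by (intro mult_left_mono) (simp_all only: of_nat_le_iff)
    then show "t * card (exceed ?h t) \<le> 2" using cK by (simp add: algebra_simps)
    have "(+) b ` K \<inter> (+) (b + m) ` K = {}" by (auto simp: K_def)
    then have "sum ?h (exceed ?h t) = (\<Sum>i\<in>K. ?h (b + i)) + (\<Sum>i\<in>K. ?h (b + m + i))"
      unfolding eq using fin by (simp add: sum.union_disjoint sum.reindex)
    also have "\<dots> = (\<Sum>i\<in>K. ?h (b + i) + ?h (b + m + i))" by (simp add: sum.distrib)
    also have "\<dots> = 0" using pos neg by (intro sum.neutral) (simp add: K_def)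
    finally show "sum ?h (exceed ?h t) = 0" .
  qed
  have "trunc_norm ?h \<le> 2 + 0"
    by (rule trunc_normI(2))
      (use * finite_exceed[OF finite_support_in_trunc_space[OF finite_support_hump]] in auto)
  then show ?thesis by simp
qed

text \<open>
  The whole sum is the sum over a level set when \<open>t\<close> is below all nonzero moduli. It is simpler
  to let \<open>t\<close> tend to \<open>0\<close> in the comparison of the sums over \<open>F\<close> and over the level set.
\<close>

lemma norm_sum_le_trunc_norm:
  assumes f: "f \<in> trunc_space" and "{n. f n \<noteq> 0} \<subseteq> F" "finite F"
  shows "norm (sum f F) \<le> trunc_norm f"
proof (rule field_le_epsilon)
  fix e :: real assume e: "0 < e"
  define t where "t = e / (card F + 1)"
  have t: "0 < t" using e by (simp add: t_def)
  have "t * card F \<le> t * (card F + 1)" using t by simp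
  also have "\<dots> = e" by (simp add: t_def)
  finally have te: "t * card F \<le> e" .
  have "exceed f t \<subseteq> F" using assms(2) t by (auto simp: exceed_def)
  then show "norm (sum f F) \<le> trunc_norm f + e"
    using norm_sum_le_of_exceed_subset[OF f _ assms(3) t] te by linarith
qed

text \<open>
  Each further use of the quasi-triangle inequality costs a factor \<open>9\<close>, so a series converges
  once its terms decrease geometrically with a ratio below \<open>1/9\<close>.
\<close>

lemma trunc_norm_sum_le:
  assumes v: "\<And>j. v j \<in> trunc_space"
  shows "trunc_norm (\<Sum>j<K. v (J + j)) \<le> (\<Sum>j<K. 9 ^ (j + 1) * trunc_norm (v (J + j)))"
proof (induction K arbitrary: J)
  case 0
  show ?case using trunc_norm_zero[where 'a = 'a] by (simp only: lessThan_0 sum.empty order_refl)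
next
  case (Suc K)
  have sum_in: "(\<Sum>j<K. w j) \<in> trunc_space" if "\<And>j. w j \<in> trunc_space" for w :: "nat \<Rightarrow> nat \<Rightarrow> 'a"
    using that by (induction K) (auto intro: zero_in_trunc_space trunc_norm_triangle)
  have "trunc_norm (\<Sum>j<Suc K. v (J + j)) = trunc_norm (v J + (\<Sum>j<K. v (Suc J + j)))"
    unfolding sum.lessThan_Suc_shift by simp
  also have "\<dots> \<le> 9 * (trunc_norm (v J) + trunc_norm (\<Sum>j<K. v (Suc J + j)))"
    by (intro trunc_norm_triangle sum_in v)
  also have "\<dots> \<le> 9 * (trunc_norm (v J) + (\<Sum>j<K. 9 ^ (j + 1) * trunc_norm (v (Suc J + j))))"
    using Suc.IH[of "Suc J"] by simp
  also have "\<dots> = (\<Sum>j<Suc K. 9 ^ (j + 1) * trunc_norm (v (J + j)))"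
    unfolding sum.lessThan_Suc_shift by (simp add: sum_distrib_left algebra_simps)
  finally show ?case .
qed

definition initial_part :: "nat \<Rightarrow> (nat \<Rightarrow> 'k::real_normed_field) \<Rightarrow> nat \<Rightarrow> 'k" where
  "initial_part m f = (\<lambda>n. if n < m then f n else 0)"

lemma harmonic_sum_ge: "\<exists>n. C \<le> (\<Sum>i<n. 1 / real (i + 1))"
proof (rule ccontr)
  assume "\<not> ?thesis"
  then have "summable (\<lambda>i. 1 / real (i + 1))"
    by (intro summableI_nonneg_bounded[of _ C]) (auto simp: not_le less_imp_le)
  then show False
    using not_summable_harmonic[where 'a = real] summable_iff_shift[of "\<lambda>i. inverse (real i)" 1]
    by (simp add: inverse_eq_divide)
qed

text \<open>
  The sequence \<open>x\<close> is the sum of consecutive blocks \<open>v j\<close>. The factor \<open>18\<^bsup>-j\<^esup>\<close> of block \<open>j\<close>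
  beats the powers of \<open>9\<close> from \<open>trunc_norm_sum_le\<close>, and its length is chosen such that the
  positive half still has sum at least \<open>1\<close>. Cutting \<open>x\<close> in the middle of block \<open>J\<close> thus leaves a
  distance of at least \<open>1\<close> to the sum \<open>u J\<close> of the blocks before it, although \<open>u J\<close> tends to
  \<open>x\<close>.
\<close>

lemma ex_initial_parts_not_convergent:
  "\<exists>x :: nat \<Rightarrow> 'k::{real_normed_field,banach}. x \<in> finitary_closure
     \<and> \<not> (\<lambda>m. trunc_norm (initial_part m x - x)) \<longlonglongrightarrow> 0"
proof -
  have "\<forall>j. \<exists>n. 18 ^ j \<le> (\<Sum>i<n. 1 / real (i + 1))" using harmonic_sum_ge by blast
  then obtain k where k: "\<And>j. 18 ^ j \<le> (\<Sum>i<k j. 1 / real (i + 1))"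
    unfolding choice_iff by blast
  define b where "b j = (\<Sum>i<j. 2 * k i)" for j
  define c where "c j = 1 / (18::real) ^ j" for j
  define v where "v j = seq_scale (of_real (c j)) (hump (b j) (k j) :: nat \<Rightarrow> 'k)" for j
  define u where "u J = (\<Sum>j<J. v j)" for J
  have b_Suc: "b (Suc j) = b j + 2 * k j" for j by (simp add: b_def)
  have c_pos: "0 < c j" for j by (simp add: c_def)
  have k_pos: "0 < k j" for j
    using less_le_trans[OF _ k[of j], of 0] by (cases "k j") auto
  have b_mono: "b i \<le> b j" if "i \<le> j" for i j
    using that by (rule lift_Suc_mono_le[rotated]) (simp add: b_Suc)
  have b_ge: "j \<le> b j" for j
  proof (induction j)
    case (Suc j)
    then show ?case using k_pos[of j] by (simp add: b_Suc)
  qed simp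
  have v_before: "v j n = 0" if "n < b j" for j n
    using that by (simp add: v_def seq_scale_def hump_outside)
  have v_after: "v j n = 0" if "b (Suc j) \<le> n" for j n
    using that by (simp add: v_def seq_scale_def hump_outside b_Suc)
  have v_mem: "v j \<in> finitary_closure" for j
    unfolding v_def
    by (intro finitary_closure_scale finite_support_in_finitary_closure finite_support_hump)
  have v_in: "v j \<in> trunc_space" for j using v_mem finitary_closure_subset by blast
  have v_le: "trunc_norm (v j) \<le> 2 * c j" for j
  proof -
    have "trunc_norm (v j) = c j * trunc_norm (hump (b j) (k j) :: nat \<Rightarrow> 'k)"
      unfolding v_def using c_pos[of j]
      by (simp add: trunc_norm_scale finite_support_in_trunc_space finite_support_hump)
    also have "\<dots> \<le> c j * 2" using c_pos[of j] by (intro mult_left_mono trunc_norm_hump_le) simp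
    finally show ?thesis by simp
  qed
  have u_mem: "u J \<in> finitary_closure" for J
    unfolding u_def by (rule trunc.subspace_sum[OF trunc.subspace_V v_mem])
  have u_in: "u J \<in> trunc_space" for J using u_mem finitary_closure_subset by blast
  have u_diff: "trunc_norm (u (J + K) - u J) \<le> 36 * c J" for J K
  proof -
    have "u (J + K) - u J = (\<Sum>j<K. v (J + j))"
    proof
      show "(u (J + K) - u J) n = (\<Sum>j<K. v (J + j)) n" for n
        unfolding sum_fun_apply by (induction K) (simp_all add: u_def sum_fun_apply)
    qed
    then have "trunc_norm (u (J + K) - u J) \<le> (\<Sum>j<K. 9 ^ (j + 1) * trunc_norm (v (J + j)))"
      using trunc_norm_sum_le[of v, OF v_in] by simp
    also have "\<dots> \<le> (\<Sum>j<K. 18 * c J * (1 / 2) ^ j)"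
    proof (rule sum_mono)
      fix j
      have "9 ^ (j + 1) * trunc_norm (v (J + j)) \<le> 9 ^ (j + 1) * (2 * c (J + j))"
        by (intro mult_left_mono v_le) simp
      also have "\<dots> = 18 * c J * ((9 / 18) ^ j)"
        unfolding c_def power_add power_divide by (simp add: field_simps)
      finally show "9 ^ (j + 1) * trunc_norm (v (J + j)) \<le> 18 * c J * (1 / 2) ^ j" by simp
    qed
    also have "\<dots> = 18 * c J * (\<Sum>j<K. (1 / 2) ^ j)" by (simp add: sum_distrib_left)
    also have "\<dots> \<le> 18 * c J * 2"
      using c_pos[of J] by (intro mult_left_mono) (simp_all add: geometric_sum)
    finally show ?thesis by simp
  qed
  have c_lim: "c \<longlonglongrightarrow> 0"
  proof -
    have "(\<lambda>j. (1 / 18 :: real) ^ j) \<longlonglongrightarrow> 0" by (rule LIMSEQ_power_zero) simp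
    then show ?thesis by (simp add: c_def[abs_def] power_divide)
  qed
  have "trunc.cauchy_seq u"
    unfolding trunc.cauchy_seq_def
  proof (intro allI impI)
    fix \<epsilon> :: real assume "0 < \<epsilon>"
    then have "\<forall>\<^sub>F j in sequentially. c j < \<epsilon> / 36"
      using c_lim by (intro order_tendstoD(2)) auto
    then obtain M where M: "\<And>j. j \<ge> M \<Longrightarrow> 36 * c j < \<epsilon>"
      unfolding eventually_sequentially by (auto simp: field_simps)
    have le: "trunc_norm (u n - u m) < \<epsilon>" if "M \<le> m" "m \<le> n" for m n
      using u_diff[of m "n - m"] M[OF that(1)] that(2) by simp
    show "\<exists>M. \<forall>m\<ge>M. \<forall>n\<ge>M. trunc_norm (u m - u n) < \<epsilon>"
    proof (intro exI allI impI)
      fix m n assume "M \<le> m" "M \<le> n"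
      then show "trunc_norm (u m - u n) < \<epsilon>"
        using le[of m n] le[of n m] trunc_norm_diff(3)[OF u_in u_in, of m n] by (cases "m \<le> n") auto
    qed
  qed
  then obtain x where x: "x \<in> finitary_closure" and ux: "(\<lambda>J. trunc_norm (u J - x)) \<longlonglongrightarrow> 0"
    using trunc.complete_V[of u] u_mem unfolding trunc.converges_to_def by blast
  have x_in: "x \<in> trunc_space" using x finitary_closure_subset by blast
  \<comment> \<open>Later blocks start later, so every coordinate of \<open>u J\<close> is eventually constant in \<open>J\<close>.\<close>
  have u_const: "u (J + K) n = u J n" if "n < b J" for J K n
  proof (induction K)
    case (Suc K)
    have "v (J + K) n = 0" using v_before that b_mono[of J "J + K"] by simp
    then show ?case using Suc by (simp add: u_def)
  qed simp
  have x_eq: "x n = u J n" if "n < b J" for n J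
  proof -
    have "norm (u J n - x n) \<le> trunc_norm (u K - x)" if "J \<le> K" for K
      using norm_coord_le[OF trunc_norm_diff(1)[OF u_in x_in], of K n]
        u_const[OF \<open>n < b J\<close>, of "K - J"] that by simp
    then have "norm (u J n - x n) \<le> 0"
      using ux by (intro LIMSEQ_le_const[of _ 0]) auto
    then show ?thesis by simp
  qed
  have u_after: "u J n = 0" if "b J \<le> n" for J n
    unfolding u_def sum_fun_apply
  proof (rule sum.neutral, rule ballI)
    fix j assume "j \<in> {..<J}"
    then have "b (Suc j) \<le> n" using b_mono[of "Suc j" J] that by simp
    then show "v j n = 0" by (rule v_after)
  qed
  define m where "m J = b J + k J" for J
  \<comment> \<open>Below \<open>m J\<close> the sequence \<open>x\<close> agrees with \<open>u (Suc J) = u J + v J\<close>, so the difference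
    is the positive half of block \<open>J\<close>.\<close>
  have far: "1 \<le> trunc_norm (initial_part (m J) x - u J)" for J
  proof -
    have mb: "m J \<le> b (Suc J)" by (simp add: m_def b_Suc)
    have eq: "initial_part (m J) x - u J = initial_part (m J) (v J)"
    proof
      fix n
      show "(initial_part (m J) x - u J) n = initial_part (m J) (v J) n"
        using x_eq[of n "Suc J"] mb u_after[of J n]
        by (auto simp: initial_part_def u_def m_def not_less)
    qed
    let ?w = "initial_part (m J) (v J)"
    have sub: "{n. ?w n \<noteq> 0} \<subseteq> {b J..<m J}"
      using v_before by (auto simp: initial_part_def not_less[symmetric] split: if_splits)
    then have "?w \<in> trunc_space"
      by (intro finite_support_in_trunc_space) (meson finite_atLeastLessThan finite_subset)
    then have "norm (sum ?w {b J..<m J}) \<le> trunc_norm ?w"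
      using sub by (rule norm_sum_le_trunc_norm) simp
    moreover have "sum ?w {b J..<m J} = of_real (c J * (\<Sum>i<k J. 1 / real (i + 1)))"
    proof -
      have "sum ?w {b J..<m J} = (\<Sum>i<k J. ?w (i + b J))"
        using sum.shift_bounds_nat_ivl[of ?w 0 "b J" "k J"]
        by (simp add: m_def add.commute atLeast0LessThan)
      also have "\<dots> = (\<Sum>i<k J. of_real (c J * (1 / real (i + 1))))"
        by (intro sum.cong) (auto simp: initial_part_def m_def v_def seq_scale_def hump_def)
      finally show ?thesis by (simp only: sum_distrib_left of_real_sum)
    qed
    moreover have "1 \<le> c J * (\<Sum>i<k J. 1 / real (i + 1))"
      using k[of J] by (simp add: c_def field_simps)
    ultimately show ?thesis unfolding eq by (simp only: norm_of_real)
  qed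
  have "\<not> (\<lambda>m. trunc_norm (initial_part m x - x)) \<longlonglongrightarrow> 0"
  proof
    assume lim: "(\<lambda>m. trunc_norm (initial_part m x - x)) \<longlonglongrightarrow> 0"
    have "filterlim m at_top sequentially"
      by (rule filterlim_at_top_mono[OF filterlim_ident])
        (use b_ge in \<open>auto simp: m_def intro!: always_eventually trans_le_add1\<close>)
    then have "(\<lambda>J. trunc_norm (initial_part (m J) x - x)) \<longlonglongrightarrow> 0"
      using lim by (rule filterlim_compose[rotated])
    then have "(\<lambda>J. 9 * (trunc_norm (initial_part (m J) x - x) + trunc_norm (u J - x)))
        \<longlonglongrightarrow> 9 * (0 + 0)"
      using ux by (intro tendsto_intros)
    moreover have "1 \<le> 9 * (trunc_norm (initial_part (m J) x - x) + trunc_norm (u J - x))" for J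
    proof -
      have "initial_part (m J) x \<in> trunc_space"
        by (rule finite_support_in_trunc_space, rule finite_subset[of _ "{..<m J}"])
          (auto simp: initial_part_def)
      then have "trunc_norm ((initial_part (m J) x - x) - (u J - x))
          \<le> 9 * (trunc_norm (initial_part (m J) x - x) + trunc_norm (u J - x))"
        by (intro trunc_norm_diff u_in x_in)
      then show ?thesis using far[of J] by simp
    qed
    ultimately have "1 \<le> 9 * (0 + 0 :: real)"
      using LIMSEQ_le_const by blast
    then show False by simp
  qed
  with x show ?thesis by blast
qed

text \<open>
  Composing with \<open>\<pi>\<close> turns an expansion along the rearranged unit vectors into one in the
  natural order, and the coefficients are forced because coordinates are continuous.
\<close>

lemma not_schauder_unit_seq:
  assumes pi: "bij \<pi>"
  shows "\<not> trunc.schauder_basis (\<lambda>n. unit_seq (\<pi> n) :: nat \<Rightarrow> 'k::{real_normed_field,banach})"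
proof
  assume S: "trunc.schauder_basis (\<lambda>n. unit_seq (\<pi> n) :: nat \<Rightarrow> 'k)"
  obtain x :: "nat \<Rightarrow> 'k" where x: "x \<in> finitary_closure"
    and div: "\<not> (\<lambda>m. trunc_norm (initial_part m x - x)) \<longlonglongrightarrow> 0"
    using ex_initial_parts_not_convergent by blast
  define f where "f = x \<circ> inv \<pi>"
  have "f \<in> finitary_closure"
    unfolding f_def using x bij_imp_bij_inv[OF pi] by (rule permute_in_finitary_closure)
  then obtain a where "trunc.converges_to (\<lambda>m. \<Sum>n<m. seq_scale (a n) (unit_seq (\<pi> n))) f"
    using S unfolding trunc.schauder_basis_def by blast
  then have lim: "(\<lambda>m. trunc_norm ((\<Sum>n<m. seq_scale (a n) (unit_seq (\<pi> n))) - f)) \<longlonglongrightarrow> 0"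
    unfolding trunc.converges_to_def .
  have perm: "((\<Sum>n<m. seq_scale (a n) (unit_seq (\<pi> n))) - f) \<circ> \<pi> = initial_part m a - x" for m
    using sum_scale_unit_seq[OF finite_lessThan bij_is_inj[OF pi], of a m] bij_is_inj[OF pi]
    by (auto simp: fun_eq_iff f_def initial_part_def)
  have lim': "(\<lambda>m. trunc_norm (initial_part m a - x)) \<longlonglongrightarrow> 0"
    using lim unfolding perm[symmetric] trunc_norm_permute(2)[OF pi] .
  have "a = x"
  proof
    fix k
    have "norm (a k - x k) \<le> trunc_norm (initial_part m a - x)" if "k < m" for m
    proof -
      have "initial_part m a \<in> trunc_space"
        by (rule finite_support_in_trunc_space, rule finite_subset[of _ "{..<m}"])
          (auto simp: initial_part_def)
      moreover have "x \<in> trunc_space" using x finitary_closure_subset by blast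
      ultimately show ?thesis
        using norm_coord_le[OF trunc_norm_diff(1), of "initial_part m a" x k] that
        by (simp add: initial_part_def)
    qed
    then have "norm (a k - x k) \<le> 0"
      using lim' by (intro LIMSEQ_le_const[of _ 0]) (auto intro!: exI[of _ "Suc k"])
    then show "a k = x k" by simp
  qed
  then show False using lim' div by simp
qed

theorem theorem4p14:
  shows "(\<exists>(V :: (nat \<Rightarrow> real) set) N y.
            quasi_banach_space seq_scale V N \<and>
            quasi_normed_space.almost_greedy_basis seq_scale V N y \<and>
            quasi_normed_space.symmetric_system seq_scale V N y \<and>
            (\<forall>\<pi>. bij \<pi> \<longrightarrow> \<not> quasi_normed_space.schauder_basis seq_scale V N (\<lambda>n. y (\<pi> n)))) \<and>
         (\<exists>(V :: (nat \<Rightarrow> complex) set) N y.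
            quasi_banach_space seq_scale V N \<and>
            quasi_normed_space.almost_greedy_basis seq_scale V N y \<and>
            quasi_normed_space.symmetric_system seq_scale V N y \<and>
            (\<forall>\<pi>. bij \<pi> \<longrightarrow> \<not> quasi_normed_space.schauder_basis seq_scale V N (\<lambda>n. y (\<pi> n))))"
  by (intro conjI exI[of _ finitary_closure] exI[of _ trunc_norm] exI[of _ unit_seq] allI impI
      trunc.quasi_banach_space_axioms almost_greedy_unit_seq symmetric_unit_seq not_schauder_unit_seq)

end
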